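(* Let $y=y[1..n]$ be a regular feasible array with negative prefix graph $\mathcal{P}_y^-$. Then the chromatic number of $\mathcal{P}_y^-$, which is also the minimum alphabet size (number of distinct letters) of a regular string whose prefix array is $y$, equals its clique number: $\chi(\mathcal{P}_y^-)=\omega(\mathcal{P}_y^-)$.
   Context: An integer array $y=y[1..n]$ is feasible if $y[1]=n$ and $0\le y[i]\le n+1-i$ for every $i\in\{2,\dots,n\}$. A regular string is an ordinary sequence $x=x[1..n]$ of single letters; its prefix array $y$ is given by $y[i]=$ the length of the longest prefix of $x[i..n]$ that equals a prefix of $x$. A feasible array is regular if it is the prefix array of some regular string. The negative prefix graph $\mathcal{P}_y^-=(V,E^-)$ of a feasible array $y$ has vertex set $V=\{1,\dots,n\}$, and its edges are exactly the pairs $(1+y[i],\,i+y[i])$ for those $i\in\{2,\dots,n\}$ with $i+y[i]\le n$. $\omega$ denotes the clique number (the order of a largest complete subgraph; $1$ if there are no edges), $\chi$ the chromatic number. *)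

theory Defs
  imports Main "HOL-Library.Sublist"
begin

text \<open>
  Arrays and strings are lists, but positions are counted from 1:
  the entry usually written \<open>y[i]\<close> is \<open>entry y i\<close>, meaningful for \<open>1 \<le> i \<le> length y\<close>.
  Entries of feasible arrays are nonnegative, so the entries are taken in \<^typ>\<open>nat\<close>.
\<close>

definition entry :: "'a list \<Rightarrow> nat \<Rightarrow> 'a" where
  "entry y i = y ! (i - 1)"

text \<open>The requirement that there is a first entry excludes the empty array.\<close>

definition feasible :: "nat list \<Rightarrow> bool" where
  "feasible y \<longleftrightarrow>
     1 \<le> length y \<and> entry y 1 = length y \<and>
     (\<forall>i\<in>{2..length y}. entry y i \<le> length y + 1 - i)"

text \<open>The suffix \<open>x[i..n]\<close> is \<^term>\<open>drop (i - 1) x\<close>.\<close>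

definition prefix_array :: "'a list \<Rightarrow> nat list" where
  "prefix_array x =
     map (\<lambda>i. length (longest_common_prefix (drop (i - 1) x) x)) [1..<length x + 1]"

text \<open>
  Letters are drawn from \<^typ>\<open>nat\<close>. This is no restriction: by \<open>ex_nat_string\<close> below, every
  string over any type has a counterpart over \<^typ>\<open>nat\<close> with the same prefix array and equally
  many distinct letters.
\<close>

definition regular :: "nat list \<Rightarrow> bool" where
  "regular y \<longleftrightarrow> (\<exists>x :: nat list. prefix_array x = y)"

text \<open>This is the intended minimum only if \<^term>\<open>regular y\<close>.\<close>

definition min_alphabet_size :: "nat list \<Rightarrow> nat" where
  "min_alphabet_size y = (LEAST k. \<exists>x :: nat list. prefix_array x = y \<and> card (set x) = k)"

lemma length_longest_common_prefix_map:
  assumes "inj_on f (set xs \<union> set ys)"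
  shows "length (longest_common_prefix (map f xs) (map f ys)) =
         length (longest_common_prefix xs ys)"
  using assms
  by (induction xs ys rule: longest_common_prefix.induct) (auto simp: inj_on_def)

lemma prefix_array_map:
  assumes "inj_on f (set x)"
  shows "prefix_array (map f x) = prefix_array x"
proof -
  have "inj_on f (set (drop k x) \<union> set x)" for k
    using assms by (simp add: Un_absorb1 set_drop_subset)
  then show ?thesis
    by (simp add: prefix_array_def drop_map length_longest_common_prefix_map)
qed

lemma ex_nat_string:
  fixes x :: "'a list"
  shows "\<exists>x' :: nat list. prefix_array x' = prefix_array x \<and> card (set x') = card (set x)"
proof -
  obtain f :: "'a \<Rightarrow> nat" where "inj_on f (set x)"
    using finite_imp_inj_to_nat_seg[of "set x"] by auto
  then show ?thesis
    by (intro exI[of _ "map f x"]) (simp add: prefix_array_map card_image)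
qed

text \<open>
  A finite simple graph is given by its vertex set \<open>V\<close> and its set \<open>E\<close> of edges, each edge being
  an unordered pair \<open>{u, v}\<close> of distinct vertices.
\<close>

definition proper_coloring :: "'a set \<Rightarrow> 'a set set \<Rightarrow> ('a \<Rightarrow> nat) \<Rightarrow> nat \<Rightarrow> bool" where
  "proper_coloring V E c k \<longleftrightarrow>
     (\<forall>v\<in>V. c v < k) \<and> (\<forall>u\<in>V. \<forall>v\<in>V. {u, v} \<in> E \<longrightarrow> c u \<noteq> c v)"

definition chromatic_number :: "'a set \<Rightarrow> 'a set set \<Rightarrow> nat" where
  "chromatic_number V E = (LEAST k. \<exists>c. proper_coloring V E c k)"

definition clique :: "'a set \<Rightarrow> 'a set set \<Rightarrow> 'a set \<Rightarrow> bool" where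
  "clique V E K \<longleftrightarrow> K \<subseteq> V \<and> (\<forall>u\<in>K. \<forall>v\<in>K. u \<noteq> v \<longrightarrow> {u, v} \<in> E)"

definition clique_number :: "'a set \<Rightarrow> 'a set set \<Rightarrow> nat" where
  "clique_number V E = Max {card K | K. clique V E K}"

definition neg_prefix_vertices :: "nat list \<Rightarrow> nat set" where
  "neg_prefix_vertices y = {1..length y}"

definition neg_prefix_edges :: "nat list \<Rightarrow> nat set set" where
  "neg_prefix_edges y =
     {{1 + entry y i, i + entry y i} | i. i \<in> {2..length y} \<and> i + entry y i \<le> length y}"

end

theory Submission
  imports Defs
begin

text \<open>
  Only the bound \<open>min_alphabet_size y \<le> \<omega>\<close> needs an idea. Let \<open>x\<close> have prefix array \<open>y\<close> and
  reassign the letters from left to right. If some prefix \<open>x[1..p]\<close> with \<open>p < j\<close> is a suffix of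
  \<open>x[1..j]\<close>, the letter at \<open>j\<close> is copied from \<open>p\<close>. Otherwise it only has to avoid the letters at
  the positions \<open>b + 1\<close> for the proper borders \<open>b\<close> of \<open>x[1..j-1]\<close>. Of two such borders the shorter
  is a border of the longer, so positions \<open>b + 1\<close> carrying different letters are adjacent in the
  graph. Picking one position for each letter to be avoided, together with \<open>j\<close>, yields a clique,
  so one of \<open>\<omega>\<close> letters is free.
\<close>

section \<open>Borders of prefixes and the reassignment of letters\<close>

text \<open>Positions are counted from 0 here.\<close>

definition border :: "(nat \<Rightarrow> 'a) \<Rightarrow> nat \<Rightarrow> nat \<Rightarrow> bool" where
  "border f p q \<longleftrightarrow> p < q \<and> (\<forall>k<p. f k = f (q - p + k))"

lemma border_Suc:
  assumes "p < q"
  shows "border f (Suc p) (Suc q) \<longleftrightarrow> border f p q \<and> f p = f q"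
  using assms by (auto simp: border_def less_Suc_eq)

text \<open>The last \<open>r\<close> letters before \<open>q\<close> are also the last
  \<open>r\<close> letters of the suffix of length \<open>p\<close>, which is a copy of the prefix
  of length \<open>p\<close>.\<close>

lemma border_of_border:
  assumes "border f p q" "border f r q" "r < p"
  shows "border f r p"
  unfolding border_def
proof (intro conjI allI impI)
  fix k assume "k < r"
  with assms have "f k = f (q - r + k)" "f (p - r + k) = f (q - p + (p - r + k))"
    by (auto simp: border_def)
  moreover have "q - p + (p - r + k) = q - r + k"
    using assms by (simp add: border_def)
  ultimately show "f k = f (p - r + k)" by simp
qed fact

text \<open>By \<open>border_Suc\<close> a border grows one letter at a time, and each step compares
  two letters only where the shorter border is already present. So \<open>g\<close> need not agree
  with \<open>f\<close> in any other comparison.\<close>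

lemma border_cong:
  assumes "\<And>p q. q < n \<Longrightarrow> border f p q \<Longrightarrow> g p = g q \<longleftrightarrow> f p = f q" and "q \<le> n"
  shows "border g p q \<longleftrightarrow> border f p q"
  using \<open>q \<le> n\<close>
proof (induction p arbitrary: q)
  case 0
  show ?case by (simp add: border_def)
next
  case (Suc p)
  show ?case
  proof (cases "Suc p < q")
    case True
    then obtain q' where "q = Suc q'" "p < q'"
      by (cases q) auto
    with Suc assms(1)[of q' p] show ?thesis
      by (auto simp: border_Suc)
  qed (simp add: border_def)
qed

text \<open>With positions shifted by one, the sets \<open>K\<close> will be cliques of the graph
  and \<open>k\<close> its clique number. The conclusion supplies just what
  \<open>border_cong\<close> assumes.\<close>

lemma greedy_letters:
  assumes "\<And>K. K \<subseteq> {..<n} \<Longrightarrow> (\<And>p q. p \<in> K \<Longrightarrow> q \<in> K \<Longrightarrow> p < q \<Longrightarrow> border f p q \<and> f p \<noteq> f q)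
    \<Longrightarrow> card K \<le> k"
  shows "\<exists>g :: nat \<Rightarrow> nat. (\<forall>q<n. g q < k) \<and>
    (\<forall>q<n. \<forall>p. border f p q \<longrightarrow> (g p = g q \<longleftrightarrow> f p = f q))"
  using assms
proof (induction n)
  case 0
  show ?case by simp
next
  case (Suc n)
  have "\<And>K. K \<subseteq> {..<n} \<Longrightarrow> K \<subseteq> {..<Suc n}"
    by auto
  with Suc obtain g :: "nat \<Rightarrow> nat" where bound: "\<And>q. q < n \<Longrightarrow> g q < k"
    and g: "\<And>p q. q < n \<Longrightarrow> border f p q \<Longrightarrow> g p = g q \<longleftrightarrow> f p = f q"
    by metis
  \<comment> \<open>A new value at \<open>n\<close> enters only the comparisons with positions in
    \<open>B\<close>; all earlier comparisons concern arguments below \<open>n\<close>.\<close>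
  define B where "B = {p. border f p n}"
  have B_less: "p < n" if "p \<in> B" for p
    using that by (simp add: B_def border_def)
  have B_border: "border f p q" if "p \<in> B" "q \<in> B" "p < q" for p q
    using that border_of_border[of f q n p] by (simp add: B_def)
  have g_B: "g p = g q \<longleftrightarrow> f p = f q" if "p \<in> B" "q \<in> B" for p q
    using that g B_border B_less by (metis linorder_neqE_nat)
  have "\<exists>a<k. \<forall>p\<in>B. g p = a \<longleftrightarrow> f p = f n"
  proof (cases "\<exists>r\<in>B. f r = f n")
    \<comment> \<open>Any such \<open>r\<close> will do: by \<open>g_B\<close>, the positions of
      \<open>B\<close> carrying the new letter \<open>g r\<close> are exactly those with old letter
      \<open>f n\<close>.\<close>
    case True
    then show ?thesis
      using g_B bound B_less by metis
  next
    case False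
    obtain R where R: "R \<subseteq> B" "inj_on g R" "g ` R = g ` B"
      by (metis subset_image_inj subset_refl)
    have "insert n R \<subseteq> {..<Suc n}"
      using R(1) B_less by fastforce
    moreover have "border f p q \<and> f p \<noteq> f q"
      if "p \<in> insert n R" "q \<in> insert n R" "p < q" for p q
    proof (cases "q = n")
      case True
      with that R(1) False show ?thesis by (auto simp: B_def)
    next
      case False
      with that R(1) B_less have "p \<in> R" "q \<in> R"
        by fastforce+
      \<comment> \<open>\<open>R\<close> was chosen by distinct values of \<open>g\<close>;
        \<open>g_B\<close> turns these into distinct values of \<open>f\<close>.\<close>
      with that R g_B B_border show ?thesis
        by (metis inj_on_eq_iff nat_neq_iff subsetD)
    qed
    ultimately have "card (insert n R) \<le> k"
      by (rule Suc.prems)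
    \<comment> \<open>Counting \<open>n\<close> itself makes the next inequality strict, which
      leaves a free letter.\<close>
    moreover have "finite R" "n \<notin> R"
      using R(1) B_less by (auto intro: finite_subset[of R "{..<n}"])
    ultimately have "card (g ` B) < k"
      using R by (metis Suc_le_eq card_image card_insert_disjoint)
    then have "\<not> {..<k} \<subseteq> g ` B"
      using B_less card_mono[of "g ` B" "{..<k}"] finite_subset[of B "{..<n}"] by auto
    then show ?thesis
      using False by auto
  qed
  then obtain a where a: "a < k" "\<And>p. p \<in> B \<Longrightarrow> g p = a \<longleftrightarrow> f p = f n"
    by blast
  have "(g(n := a)) q < k" if "q < Suc n" for q
    using that a bound by (auto simp: less_Suc_eq)
  moreover have "(g(n := a)) p = (g(n := a)) q \<longleftrightarrow> f p = f q"
    if "q < Suc n" "border f p q" for p q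
  proof (cases "q = n")
    case True
    with that a(2)[of p] show ?thesis by (auto simp: B_def border_def)
  next
    case False
    with that have "q < n" "p < n" by (auto simp: border_def)
    with that g show ?thesis by simp
  qed
  ultimately show ?case by blast
qed

section \<open>Prefix arrays and edges in terms of borders\<close>

lemma le_length_longest_common_prefix_iff:
  "m \<le> length (longest_common_prefix xs ys) \<longleftrightarrow>
     m \<le> length xs \<and> m \<le> length ys \<and> (\<forall>k<m. xs ! k = ys ! k)"
proof (induction xs ys arbitrary: m rule: longest_common_prefix.induct)
  case (1 x xs y ys)
  then show ?case
    by (cases m) (auto simp: All_less_Suc2)
qed auto

lemma longest_common_prefix_self [simp]: "longest_common_prefix xs xs = xs"
  by (induction xs) auto

lemma length_prefix_array [simp]: "length (prefix_array x) = length x"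
  by (simp add: prefix_array_def del: upt_Suc)

lemma prefix_array_nth:
  "d < length x \<Longrightarrow> prefix_array x ! d = length (longest_common_prefix (drop d x) x)"
  by (simp add: prefix_array_def del: upt_Suc)

text \<open>A match of length \<open>p\<close> at shift \<open>q - p\<close> ends at
  \<open>q\<close>, so it is a border of the prefix of length \<open>q\<close>. The bound on
  \<open>q\<close> keeps the match inside the list, which \<open>border\<close> itself does
  not.\<close>

lemma le_prefix_array_nth_iff:
  assumes "p < q" "q - p < length x"
  shows "p \<le> prefix_array x ! (q - p) \<longleftrightarrow> q \<le> length x \<and> border ((!) x) p q"
  using assms
  by (auto simp: prefix_array_nth le_length_longest_common_prefix_iff border_def)

lemma prefix_array_eqI:
  assumes "length x' = length x"
    and "\<And>p q. q \<le> length x \<Longrightarrow> border ((!) x') p q \<longleftrightarrow> border ((!) x) p q"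
  shows "prefix_array x' = prefix_array x"
proof (rule nth_equalityI)
  fix d assume "d < length (prefix_array x')"
  then have d: "d < length x" by (simp add: assms)
  show "prefix_array x' ! d = prefix_array x ! d"
  \<comment> \<open>Borders are proper and say nothing about shift 0, where the entry is the
    length.\<close>
  proof (cases "d = 0")
    case True
    with d assms(1) show ?thesis
      by (simp add: prefix_array_nth)
  next
    case False
    then have "p \<le> prefix_array x' ! d \<longleftrightarrow> p \<le> prefix_array x ! d" for p
      using d assms le_prefix_array_nth_iff[of p "d + p" x]
        le_prefix_array_nth_iff[of p "d + p" x'] by auto
    then show ?thesis by (meson order_antisym order_refl)
  qed
qed (simp add: assms)

text \<open>The difference of the endpoints determines the shift, so an edge says that the entry
  there is exactly \<open>p\<close>: the first \<open>p\<close> letters match and the next ones, at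
  \<open>p\<close> and \<open>q\<close>, differ.\<close>

lemma neg_prefix_edge_iff:
  assumes "p < q" "q < length x"
  shows "{Suc p, Suc q} \<in> neg_prefix_edges (prefix_array x) \<longleftrightarrow>
    border ((!) x) p q \<and> x ! p \<noteq> x ! q"
proof -
  have "{Suc p, Suc q} \<in> neg_prefix_edges (prefix_array x) \<longleftrightarrow> prefix_array x ! (q - p) = p"
  proof
    assume "{Suc p, Suc q} \<in> neg_prefix_edges (prefix_array x)"
    then obtain i where "2 \<le> i"
      and "{Suc p, Suc q} = {1 + prefix_array x ! (i - 1), i + prefix_array x ! (i - 1)}"
      by (auto simp: neg_prefix_edges_def entry_def)
    \<comment> \<open>Since \<open>2 \<le> i\<close>, the first listed endpoint is the smaller one,
      which settles how the two sets match.\<close>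
    with assms(1) have "p = prefix_array x ! (i - 1)" "q - p = i - 1"
      by (auto simp: doubleton_eq_iff)
    then show "prefix_array x ! (q - p) = p" by simp
  next
    assume "prefix_array x ! (q - p) = p"
    with assms show "{Suc p, Suc q} \<in> neg_prefix_edges (prefix_array x)"
      by (auto simp: neg_prefix_edges_def entry_def intro!: exI[of _ "Suc (q - p)"])
  qed
  also have "\<dots> \<longleftrightarrow>
      p \<le> prefix_array x ! (q - p) \<and> \<not> Suc p \<le> prefix_array x ! (Suc q - Suc p)"
    by auto
  also have "\<dots> \<longleftrightarrow> border ((!) x) p q \<and> x ! p \<noteq> x ! q"
    using assms le_prefix_array_nth_iff[of p q x] le_prefix_array_nth_iff[of "Suc p" "Suc q" x]
    by (auto simp: border_Suc)
  finally show ?thesis .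
qed

section \<open>Colorings and cliques\<close>

lemma card_clique_le:
  assumes "proper_coloring V E c k" "clique V E K"
  shows "card K \<le> k"
proof -
  have "inj_on c K"
    using assms unfolding inj_on_def proper_coloring_def clique_def by (meson subsetD)
  moreover have "c ` K \<subseteq> {..<k}"
    using assms by (auto simp: proper_coloring_def clique_def)
  ultimately show ?thesis
    by (metis card_inj_on_le card_lessThan finite_lessThan)
qed

lemma neg_prefix_edge_letters:
  assumes "u \<in> {1..length x}" "v \<in> {1..length x}" "{u, v} \<in> neg_prefix_edges (prefix_array x)"
  shows "x ! (u - 1) \<noteq> x ! (v - 1)"
proof -
  have less: "x ! (a - 1) \<noteq> x ! (b - 1)"
    if "a \<in> {1..length x}" "b \<in> {1..length x}" "a < b"
      "{a, b} \<in> neg_prefix_edges (prefix_array x)" for a b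
    using that neg_prefix_edge_iff[of "a - 1" "b - 1" x] by auto
  \<comment> \<open>An edge is no loop, because its index is at least 2.\<close>
  have "u \<noteq> v"
    using assms(3) by (force simp: neg_prefix_edges_def doubleton_eq_iff)
  with assms less[of u v] less[of v u] show ?thesis
    by (metis insert_commute linorder_neqE_nat)
qed

text \<open>The letters themselves color the graph, as edges join mismatched positions;
  \<open>h\<close> only renumbers the letters.\<close>

lemma ex_proper_coloring:
  fixes x :: "'a list"
  assumes "prefix_array x = y"
  shows "\<exists>c. proper_coloring (neg_prefix_vertices y) (neg_prefix_edges y) c (card (set x))"
proof -
  obtain h where h: "bij_betw h (set x) {0..<card (set x)}"
    using ex_bij_betw_finite_nat by blast
  have "proper_coloring (neg_prefix_vertices y) (neg_prefix_edges y)
      (\<lambda>v. h (x ! (v - 1))) (card (set x))"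
    unfolding proper_coloring_def neg_prefix_vertices_def assms[symmetric] length_prefix_array
  proof (intro conjI ballI impI)
    fix v assume "v \<in> {1..length x}"
    then have "x ! (v - 1) \<in> set x" by auto
    with h show "h (x ! (v - 1)) < card (set x)"
      using bij_betw_apply by fastforce
  next
    fix u v assume uv: "u \<in> {1..length x}" "v \<in> {1..length x}"
      and e: "{u, v} \<in> neg_prefix_edges (prefix_array x)"
    from uv have "x ! (u - 1) \<in> set x" "x ! (v - 1) \<in> set x" by auto
    with neg_prefix_edge_letters[OF uv e] h show "h (x ! (u - 1)) \<noteq> h (x ! (v - 1))"
      by (auto simp: bij_betw_def inj_on_eq_iff)
  qed
  then show ?thesis by blast
qed

lemma card_le_clique_number:
  assumes "finite V" "clique V E K"
  shows "card K \<le> clique_number V E"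
  unfolding clique_number_def
proof (rule Max_ge)
  have "{card K |K. clique V E K} \<subseteq> card ` Pow V"
    by (auto simp: clique_def)
  with \<open>finite V\<close> show "finite {card K |K. clique V E K}"
    by (simp add: finite_subset)
qed (use assms in auto)

lemma clique_number_le:
  assumes "finite V" "proper_coloring V E c k"
  shows "clique_number V E \<le> k"
proof -
  have "{card K |K. clique V E K} \<subseteq> card ` Pow V"
    by (auto simp: clique_def)
  with \<open>finite V\<close> have "finite {card K |K. clique V E K}"
    by (simp add: finite_subset)
  \<comment> \<open>The empty clique ensures that \<open>Max\<close> is taken over a nonempty
    set.\<close>
  moreover have "clique V E {}" by (simp add: clique_def)
  then have "{card K |K. clique V E K} \<noteq> {}" by blast
  ultimately show ?thesis
    unfolding clique_number_def using card_clique_le[OF assms(2)] by auto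
qed

section \<open>A string over at most \<omega> letters, and the conclusion\<close>

lemma ex_string_le_clique_number:
  fixes x :: "'a list"
  assumes "prefix_array x = y"
  shows "\<exists>x' :: nat list. prefix_array x' = y \<and>
    card (set x') \<le> clique_number (neg_prefix_vertices y) (neg_prefix_edges y)"
proof -
  let ?n = "length x" and ?k = "clique_number (neg_prefix_vertices y) (neg_prefix_edges y)"
  have "card K \<le> ?k"
    if "K \<subseteq> {..<?n}"
      and K: "\<And>p q. p \<in> K \<Longrightarrow> q \<in> K \<Longrightarrow> p < q \<Longrightarrow> border ((!) x) p q \<and> x ! p \<noteq> x ! q" for K
  proof -
    have edge: "{Suc p, Suc q} \<in> neg_prefix_edges y" if "p \<in> K" "q \<in> K" "p < q" for p q
      using that K[OF that] \<open>K \<subseteq> {..<?n}\<close> neg_prefix_edge_iff[of p q x] assms by auto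
    have "{Suc p, Suc q} \<in> neg_prefix_edges y" if "p \<in> K" "q \<in> K" "p \<noteq> q" for p q
      using that edge by (metis insert_commute linorder_neqE_nat)
    moreover have "Suc ` K \<subseteq> neg_prefix_vertices y"
      using \<open>K \<subseteq> {..<?n}\<close> by (auto simp: neg_prefix_vertices_def assms[symmetric])
    ultimately have "clique (neg_prefix_vertices y) (neg_prefix_edges y) (Suc ` K)"
      by (auto simp: clique_def)
    then have "card (Suc ` K) \<le> ?k"
      by (rule card_le_clique_number[rotated]) (simp add: neg_prefix_vertices_def)
    then show ?thesis by (simp add: card_image)
  qed
  then obtain g :: "nat \<Rightarrow> nat" where bound: "\<forall>q<?n. g q < ?k"
    and g: "\<forall>q<?n. \<forall>p. border ((!) x) p q \<longrightarrow> (g p = g q \<longleftrightarrow> x ! p = x ! q)"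
    using greedy_letters[of ?n "(!) x" ?k] by blast
  define x' where "x' = map g [0..<?n]"
  have "x' ! p = x' ! q \<longleftrightarrow> x ! p = x ! q" if "q < ?n" "border ((!) x) p q" for p q
  proof -
    have "p < q" using that by (simp add: border_def)
    with that g show ?thesis by (simp add: x'_def)
  qed
  then have "border ((!) x') p q \<longleftrightarrow> border ((!) x) p q" if "q \<le> ?n" for p q
    using that by (rule border_cong)
  then have "prefix_array x' = y"
    using prefix_array_eqI[of x' x] assms by (simp add: x'_def)
  moreover have "set x' \<subseteq> {..<?k}"
    using bound by (auto simp: x'_def)
  then have "card (set x') \<le> ?k"
    using card_mono[of "{..<?k}"] by fastforce
  ultimately show ?thesis by blast
qed

theorem corollary14:
  fixes y :: "nat list"
  assumes "feasible y" and "regular y"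
  shows "chromatic_number (neg_prefix_vertices y) (neg_prefix_edges y) = min_alphabet_size y
    \<and> chromatic_number (neg_prefix_vertices y) (neg_prefix_edges y)
        = clique_number (neg_prefix_vertices y) (neg_prefix_edges y)"
proof -
  let ?V = "neg_prefix_vertices y" and ?E = "neg_prefix_edges y"
  obtain x :: "nat list" where x: "prefix_array x = y"
    using \<open>regular y\<close> by (auto simp: regular_def)
  \<comment> \<open>A \<open>LEAST\<close> is attained once there is a witness; \<open>x\<close>
    provides one here and for the alphabet size below.\<close>
  have "\<exists>c. proper_coloring ?V ?E c (chromatic_number ?V ?E)"
    unfolding chromatic_number_def using ex_proper_coloring[OF x] by (rule LeastI)
  \<comment> \<open>The inequalities close up to a cycle: \<omega> \<le> \<chi> \<le>
    \<open>min_alphabet_size y\<close> \<le> \<open>card (set x')\<close> \<le> \<omega>.\<close>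
  then have "clique_number ?V ?E \<le> chromatic_number ?V ?E"
    using clique_number_le[of ?V] by (auto simp: neg_prefix_vertices_def)
  moreover have "\<exists>x :: nat list. prefix_array x = y \<and> card (set x) = min_alphabet_size y"
    unfolding min_alphabet_size_def by (rule LeastI[of _ "card (set x)"]) (use x in blast)
  then have "chromatic_number ?V ?E \<le> min_alphabet_size y"
    unfolding chromatic_number_def by (metis ex_proper_coloring Least_le)
  moreover obtain x' :: "nat list" where x': "prefix_array x' = y" "card (set x') \<le> clique_number ?V ?E"
    using ex_string_le_clique_number[OF x] by blast
  have "min_alphabet_size y \<le> card (set x')"
    unfolding min_alphabet_size_def by (rule Least_le) (use x' in blast)
  ultimately show ?thesis
    using x'(2) by linarith
qed

end
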